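(* Let $G=(V,E)$ be a connected finite graph with positive symmetric edge weights $w_{xy}$ and a measure $\mu:V\to\mathbb{R}^{+}$, and let $h:V\to\mathbb{R}$ be a positive function. Let $$\mathbf{H}=\left\{u\in \mathbf{W}^{1,2}(V)\;\Big|\;\int_V u\,d\mu=0\right\},\qquad J_{\alpha,\beta}(u)=\frac12\int_V\left(|\nabla u|^2-\alpha u^2\right)d\mu-\beta\log\int_V he^u\,d\mu .$$ Let $\lambda_1(V)<\lambda_2(V)<\cdots<\lambda_{m-1}(V)$ be all the distinct non-zero eigenvalues of $-\Delta$, let $E_{\lambda_s(V)}$ be the eigenspace of $\lambda_s(V)$ with orthonormal basis $\{u_{si}\}_{i=1}^{n_s}$, and let $k\ge1$ be an integer with $k+1\le m-1$. Put $E_k=E_{\lambda_1(V)}\oplus\cdots\oplus E_{\lambda_k(V)}$ and $E_k^{\perp}=\{u\in\mathbf{H}\mid\int_V uv\,d\mu=0\ \ \forall v\in E_k\}$. Then for any $\alpha<\lambda_{k+1}(V)$ and any $\beta\in\mathbb{R}$, $J_{\alpha,\beta}$ has a minimizer in $E_k^{\perp}$, i.e. there is $u\in E_k^{\perp}$ with $J_{\alpha,\beta}(u)=\inf_{v\in E_k^{\perp}}J_{\alpha,\beta}(v)$. Moreover, the Kazdan-Warner equation $$\Delta u+\alpha u=-\frac{\beta he^{u}}{\int_V he^{u}\,d\mu}+\frac{\beta}{\mathrm{Vol}(V)}+\sum_{s=1}^{k}\sum_{i=1}^{n_s}\frac{\beta\int_V hu_{si}e^{u}\,d\mu}{\int_V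 he^{u}\,d\mu}\,u_{si}\quad\text{on }V$$ has a solution $u\in E_k^{\perp}$.
   Context: $G=(V,E)$ is a finite connected graph; each edge $xy\in E$ has a weight $w_{xy}>0$ with $w_{xy}=w_{yx}$; $y\sim x$ means $xy\in E$; $\mu:V\to\mathbb{R}^{+}$ is a positive finite measure. For $u:V\to\mathbb{R}$, $$\Delta u(x)=\frac{1}{\mu(x)}\sum_{y\sim x}w_{xy}[u(y)-u(x)],\qquad |\nabla u|(x)=\left\{\frac{1}{2\mu(x)}\sum_{y\sim x}w_{xy}[u(y)-u(x)]^2\right\}^{1/2}.$$ For $g:V\to\mathbb{R}$, $\int_V g\,d\mu=\sum_{x\in V}\mu(x)g(x)$, and $\mathrm{Vol}(V)=\sum_{x\in V}\mu(x)$. The Sobolev space is $\mathbf{W}^{1,2}(V)=\{u:V\to\mathbb{R}\mid\int_V(|\nabla u|^2+u^2)\,d\mu<+\infty\}$ (since $V$ is finite, this is the space of all functions on $V$). The $(k+1)$-th (distinct) non-zero eigenvalue is $$\lambda_{k+1}(V)=\inf_{u\in E_k^{\perp},\ \int_V u^2\,d\mu=1}\int_V|\nabla u|^2\,d\mu ,$$ and $E_{\lambda_s(V)}=\{u:V\to\mathbb{R}\mid-\Delta u=\lambda_s(V)u\}$, of dimension $n_s$. Orthonormality is with respect to the inner product $\int_V uv\,d\mu$. *)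

theory Defs
  imports Complex_Main
begin

text \<open>
  The vertex set of the finite graph is a finite type \<open>'v\<close>, so that a function on the vertex set
  is just \<open>u :: 'v \<Rightarrow> real\<close>. Edges are given by a symmetric relation \<open>E\<close>; the values \<open>w x y\<close> off
  \<open>E\<close> are never used. Loops are not excluded: they contribute nothing to the operators below.
\<close>

definition weighted_graph ::
  "('v::finite \<times> 'v) set \<Rightarrow> ('v \<Rightarrow> 'v \<Rightarrow> real) \<Rightarrow> ('v \<Rightarrow> real) \<Rightarrow> bool" where
  "weighted_graph E w \<mu> \<longleftrightarrow>
     sym E \<and> (\<forall>x y. (x, y) \<in> E\<^sup>*) \<and>
     (\<forall>x y. (x, y) \<in> E \<longrightarrow> w x y > 0 \<and> w x y = w y x) \<and>
     (\<forall>x. \<mu> x > 0)"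

definition laplacian ::
  "('v::finite \<times> 'v) set \<Rightarrow> ('v \<Rightarrow> 'v \<Rightarrow> real) \<Rightarrow> ('v \<Rightarrow> real) \<Rightarrow> ('v \<Rightarrow> real) \<Rightarrow> 'v \<Rightarrow> real" where
  "laplacian E w \<mu> u x = 1 / \<mu> x * (\<Sum>y | (x, y) \<in> E. w x y * (u y - u x))"

definition grad_norm ::
  "('v::finite \<times> 'v) set \<Rightarrow> ('v \<Rightarrow> 'v \<Rightarrow> real) \<Rightarrow> ('v \<Rightarrow> real) \<Rightarrow> ('v \<Rightarrow> real) \<Rightarrow> 'v \<Rightarrow> real" where
  "grad_norm E w \<mu> u x = sqrt (1 / (2 * \<mu> x) * (\<Sum>y | (x, y) \<in> E. w x y * (u y - u x)\<^sup>2))"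

definition vint :: "('v::finite \<Rightarrow> real) \<Rightarrow> ('v \<Rightarrow> real) \<Rightarrow> real" where
  "vint \<mu> g = (\<Sum>x\<in>UNIV. \<mu> x * g x)"

definition Vol :: "('v::finite \<Rightarrow> real) \<Rightarrow> real" where
  "Vol \<mu> = (\<Sum>x\<in>UNIV. \<mu> x)"

text \<open>
  As the vertex set is finite, the Sobolev space \<open>W\<^sup>1\<^sup>,\<^sup>2\<close> of all \<open>u\<close> whose \<open>|\<nabla>u|\<^sup>2 + u\<^sup>2\<close> has finite
  integral consists of all real functions, so only the mean-zero condition remains in \<open>H\<close>.
\<close>

definition H_space :: "('v::finite \<Rightarrow> real) \<Rightarrow> ('v \<Rightarrow> real) set" where
  "H_space \<mu> = {u. vint \<mu> u = 0}"

definition J_functional ::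
  "('v::finite \<times> 'v) set \<Rightarrow> ('v \<Rightarrow> 'v \<Rightarrow> real) \<Rightarrow> ('v \<Rightarrow> real) \<Rightarrow> ('v \<Rightarrow> real) \<Rightarrow> real \<Rightarrow> real
     \<Rightarrow> ('v \<Rightarrow> real) \<Rightarrow> real" where
  "J_functional E w \<mu> h \<alpha> \<beta> u =
     1 / 2 * vint \<mu> (\<lambda>x. (grad_norm E w \<mu> u x)\<^sup>2 - \<alpha> * (u x)\<^sup>2)
     - \<beta> * ln (vint \<mu> (\<lambda>x. h x * exp (u x)))"

definition eigenspace ::
  "('v::finite \<times> 'v) set \<Rightarrow> ('v \<Rightarrow> 'v \<Rightarrow> real) \<Rightarrow> ('v \<Rightarrow> real) \<Rightarrow> real \<Rightarrow> ('v \<Rightarrow> real) set" where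
  "eigenspace E w \<mu> l = {u. \<forall>x. - laplacian E w \<mu> u x = l * u x}"

definition eigenvalue ::
  "('v::finite \<times> 'v) set \<Rightarrow> ('v \<Rightarrow> 'v \<Rightarrow> real) \<Rightarrow> ('v \<Rightarrow> real) \<Rightarrow> real \<Rightarrow> bool" where
  "eigenvalue E w \<mu> l \<longleftrightarrow> (\<exists>u \<in> eigenspace E w \<mu> l. \<exists>x. u x \<noteq> 0)"

text \<open>\<open>b 1, \<dots>, b n\<close> is an orthonormal basis of \<open>S\<close>; independence follows from orthonormality.\<close>

definition orthonormal_basis ::
  "('v::finite \<Rightarrow> real) \<Rightarrow> ('v \<Rightarrow> real) set \<Rightarrow> nat \<Rightarrow> (nat \<Rightarrow> 'v \<Rightarrow> real) \<Rightarrow> bool" where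
  "orthonormal_basis \<mu> S n b \<longleftrightarrow>
     (\<forall>i\<in>{1..n}. b i \<in> S) \<and>
     (\<forall>i\<in>{1..n}. \<forall>j\<in>{1..n}. vint \<mu> (\<lambda>x. b i x * b j x) = (if i = j then 1 else 0)) \<and>
     (\<forall>u\<in>S. \<exists>c :: nat \<Rightarrow> real. \<forall>x. u x = (\<Sum>i=1..n. c i * b i x))"

text \<open>
  The sum of the eigenspaces of \<open>lam 1, \<dots>, lam k\<close>. It is direct when these numbers are distinct.
\<close>

definition E_sum ::
  "('v::finite \<times> 'v) set \<Rightarrow> ('v \<Rightarrow> 'v \<Rightarrow> real) \<Rightarrow> ('v \<Rightarrow> real) \<Rightarrow> (nat \<Rightarrow> real) \<Rightarrow> nat
     \<Rightarrow> ('v \<Rightarrow> real) set" where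
  "E_sum E w \<mu> lam k =
     {(\<lambda>x. \<Sum>s=1..k. v s x) | v. \<forall>s\<in>{1..k}. v s \<in> eigenspace E w \<mu> (lam s)}"

definition E_perp ::
  "('v::finite \<times> 'v) set \<Rightarrow> ('v \<Rightarrow> 'v \<Rightarrow> real) \<Rightarrow> ('v \<Rightarrow> real) \<Rightarrow> (nat \<Rightarrow> real) \<Rightarrow> nat
     \<Rightarrow> ('v \<Rightarrow> real) set" where
  "E_perp E w \<mu> lam k =
     {u \<in> H_space \<mu>. \<forall>v \<in> E_sum E w \<mu> lam k. vint \<mu> (\<lambda>x. u x * v x) = 0}"

end

theory Submission
  imports Defs "HOL-Analysis.Function_Topology"
begin

text \<open>
  On the finite-dimensional space \<open>E_perp\<close> the functional \<open>J\<close> is continuous, so a minimizer exists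
  once \<open>J\<close> is coercive. The quadratic part is coercive because of the spectral gap
  \<open>\<integral>|\<nabla>u|\<^sup>2 \<ge> \<lambda>\<^sub>k\<^sub>+\<^sub>1 \<integral>u\<^sup>2\<close> on \<open>E_perp\<close> (\<open>spectral_gap\<close>), and the logarithm grows only like \<open>max |u|\<close>
  (\<open>abs_ln_partition_le\<close>), which a positive multiple of \<open>\<integral>u\<^sup>2\<close> dominates (\<open>J_coercive\<close>).

  The gap needs no diagonalization of the Laplacian: a minimizer of the Rayleigh quotient on the unit
  sphere of \<open>E_perp\<close> is an eigenfunction, since \<open>E_perp\<close> is invariant under the Laplacian. Its
  eigenvalue is non-zero, as a harmonic function on a connected graph is constant and the
  only constant of mean zero is 0; and it is none of \<open>\<lambda>\<^sub>1, \<dots>, \<lambda>\<^sub>k\<close>, as the eigenfunction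
  would then be orthogonal to itself. Hence it is at least \<open>\<lambda>\<^sub>k\<^sub>+\<^sub>1\<close>.

  For the equation, let \<open>R\<close> be the difference of its two sides at the minimizer \<open>u\<close>. Subtracting the
  projections of \<open>h e\<^sup>u\<close> onto the constants and onto the \<open>u\<^sub>s\<^sub>i\<close> makes \<open>R\<close> an element of \<open>E_perp\<close>, so the
  first variation of \<open>J\<close> at \<open>u\<close> vanishes in the direction \<open>R\<close> (\<open>first_variation\<close>). As the projection
  terms are orthogonal to \<open>R\<close>, this variation is, up to sign, \<open>\<integral>R\<^sup>2\<close>, and so \<open>R = 0\<close>.
\<close>

section \<open>Integration by parts\<close>

abbreviation (input) ip :: "('v::finite \<Rightarrow> real) \<Rightarrow> ('v \<Rightarrow> real) \<Rightarrow> ('v \<Rightarrow> real) \<Rightarrow> real" where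
  "ip \<mu> u v \<equiv> vint \<mu> (\<lambda>x. u x * v x)"

definition dirichlet_form ::
  "('v::finite \<times> 'v) set \<Rightarrow> ('v \<Rightarrow> 'v \<Rightarrow> real) \<Rightarrow> ('v \<Rightarrow> real) \<Rightarrow> ('v \<Rightarrow> real) \<Rightarrow> real" where
  "dirichlet_form E w u v =
     1 / 2 * (\<Sum>x\<in>UNIV. \<Sum>y | (x, y) \<in> E. w x y * ((u y - u x) * (v y - v x)))"

lemma vint_add: "vint \<mu> (\<lambda>x. f x + g x) = vint \<mu> f + vint \<mu> g"
  by (simp add: vint_def algebra_simps sum.distrib)

lemma vint_diff: "vint \<mu> (\<lambda>x. f x - g x) = vint \<mu> f - vint \<mu> g"
  by (simp add: vint_def algebra_simps sum_subtractf)

lemma vint_cmult: "vint \<mu> (\<lambda>x. c * f x) = c * vint \<mu> f"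
  by (simp add: vint_def algebra_simps sum_distrib_left)

lemma vint_sum: "vint \<mu> (\<lambda>x. \<Sum>i\<in>I. f i x) = (\<Sum>i\<in>I. vint \<mu> (f i))"
  by (simp add: vint_def sum_distrib_left sum.swap[of _ _ I])

lemma ip_commute: "ip \<mu> u v = ip \<mu> v u"
  by (simp add: mult.commute)

lemma weighted_graph_measure_pos: "weighted_graph E w \<mu> \<Longrightarrow> 0 < \<mu> x"
  by (simp add: weighted_graph_def)

lemma vint_pos:
  assumes "\<And>x. 0 < \<mu> x" "\<And>x. 0 < f x"
  shows "0 < vint \<mu> f"
  unfolding vint_def using assms by (intro sum_pos) auto

lemma ip_self_eq_0D:
  assumes "\<And>x. 0 < \<mu> x" "ip \<mu> u u = 0"
  shows "u x = 0"
proof -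
  have "\<forall>x\<in>UNIV. \<mu> x * (u x * u x) = 0"
    using assms(2) unfolding vint_def
    by (subst (asm) sum_nonneg_eq_0_iff) (auto simp: less_imp_le[OF assms(1)])
  then show ?thesis using assms(1)[of x] by (auto dest!: spec[of _ x])
qed

lemma ip_self_nonneg: "(\<And>x. 0 < \<mu> x) \<Longrightarrow> 0 \<le> ip \<mu> u u"
  unfolding vint_def by (intro sum_nonneg) (simp add: less_imp_le)

lemma edge_sum_swap:
  assumes "weighted_graph E w \<mu>"
  shows "(\<Sum>x\<in>UNIV. \<Sum>y | (x, y) \<in> E. w x y * f x y) =
         (\<Sum>x\<in>UNIV. \<Sum>y | (x, y) \<in> E. w x y * f y x)"
proof -
  have sym: "(y, x) \<in> E \<and> w y x = w x y" if "(x, y) \<in> E" for x y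
    using assms that by (auto simp: weighted_graph_def sym_def)
  have E_sum: "(\<Sum>y | (x, y) \<in> E. g y) = (\<Sum>y\<in>UNIV. if (x, y) \<in> E then g y else 0)"
    for x and g :: "'a \<Rightarrow> real"
    by (simp add: sum.If_cases)
  have "(\<Sum>x\<in>UNIV. \<Sum>y\<in>UNIV. if (x, y) \<in> E then w x y * f x y else 0) =
        (\<Sum>y\<in>UNIV. \<Sum>x\<in>UNIV. if (x, y) \<in> E then w x y * f x y else 0)"
    by (rule sum.swap)
  also have "\<dots> = (\<Sum>y\<in>UNIV. \<Sum>x\<in>UNIV. if (y, x) \<in> E then w y x * f x y else 0)"
    using sym by (intro sum.cong refl) (auto split: if_splits)
  finally show ?thesis by (simp only: E_sum)
qed

text \<open>
  Summation by parts: averaging the edge sum for \<open>\<integral>\<Delta>u v\<close> with the one in which every edge is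
  traversed backwards symmetrizes it.
\<close>

lemma green_formula:
  assumes "weighted_graph E w \<mu>"
  shows "ip \<mu> (laplacian E w \<mu> u) v = - dirichlet_form E w u v"
proof -
  let ?S = "\<lambda>f. \<Sum>x\<in>UNIV. \<Sum>y | (x, y) \<in> E. w x y * f x y"
  have "ip \<mu> (laplacian E w \<mu> u) v = ?S (\<lambda>x y. (u y - u x) * v x)"
    unfolding vint_def laplacian_def
    using weighted_graph_measure_pos[OF assms]
    by (intro sum.cong refl) (simp add: less_imp_neq[THEN not_sym] sum_distrib_right mult.assoc)
  moreover have "?S (\<lambda>x y. (u y - u x) * v x) = ?S (\<lambda>x y. (u x - u y) * v y)"
    by (rule edge_sum_swap[OF assms])
  moreover have "?S (\<lambda>x y. (u y - u x) * v x) + ?S (\<lambda>x y. (u x - u y) * v y) =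
      - ?S (\<lambda>x y. (u y - u x) * (v y - v x))"
    unfolding sum.distrib[symmetric] sum_negf[symmetric]
    by (intro sum.cong refl) (simp add: algebra_simps)
  ultimately show ?thesis by (simp add: dirichlet_form_def)
qed

lemma dirichlet_form_commute: "dirichlet_form E w u v = dirichlet_form E w v u"
  by (simp add: dirichlet_form_def mult.commute[of "u _ - _"])

lemma laplacian_self_adjoint:
  assumes "weighted_graph E w \<mu>"
  shows "ip \<mu> (laplacian E w \<mu> u) v = ip \<mu> u (laplacian E w \<mu> v)"
  using green_formula[OF assms, of u v] green_formula[OF assms, of v u]
  by (simp add: dirichlet_form_commute[of E w u v] mult.commute)

lemma dirichlet_form_add_scaled:
  "dirichlet_form E w (\<lambda>x. u x + t * v x) (\<lambda>x. u x + t * v x) =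
     dirichlet_form E w u u + 2 * t * dirichlet_form E w u v + t\<^sup>2 * dirichlet_form E w v v"
  by (simp add: dirichlet_form_def algebra_simps power2_eq_square sum.distrib sum_subtractf
      sum_distrib_left)

lemma ip_add_scaled:
  "ip \<mu> (\<lambda>x. u x + t * v x) (\<lambda>x. u x + t * v x) =
     ip \<mu> u u + 2 * t * ip \<mu> u v + t\<^sup>2 * ip \<mu> v v"
  by (simp add: vint_def algebra_simps power2_eq_square sum.distrib sum_distrib_left)

lemma dirichlet_form_scaled:
  "dirichlet_form E w (\<lambda>x. c * u x) (\<lambda>x. c * u x) = c\<^sup>2 * dirichlet_form E w u u"
  by (simp add: dirichlet_form_def algebra_simps power2_eq_square sum_distrib_left)

lemma vint_grad_norm_sq:
  assumes "weighted_graph E w \<mu>"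
  shows "vint \<mu> (\<lambda>x. (grad_norm E w \<mu> u x)\<^sup>2) = dirichlet_form E w u u"
proof -
  have "\<mu> x * (grad_norm E w \<mu> u x)\<^sup>2 =
      1 / 2 * (\<Sum>y | (x, y) \<in> E. w x y * ((u y - u x) * (u y - u x)))" for x
  proof -
    have "0 \<le> w x y" if "(x, y) \<in> E" for y
      using assms that by (simp add: weighted_graph_def less_imp_le)
    then have "0 \<le> (\<Sum>y | (x, y) \<in> E. w x y * (u y - u x)\<^sup>2)"
      by (intro sum_nonneg mult_nonneg_nonneg) auto
    with weighted_graph_measure_pos[OF assms, of x] show ?thesis
      by (simp add: grad_norm_def power2_eq_square)
  qed
  then show ?thesis
    by (simp add: vint_def dirichlet_form_def sum_distrib_left)
qed

lemma J_functional_eq: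
  assumes "weighted_graph E w \<mu>"
  shows "J_functional E w \<mu> h \<alpha> \<beta> u =
    1 / 2 * (dirichlet_form E w u u - \<alpha> * ip \<mu> u u) - \<beta> * ln (vint \<mu> (\<lambda>x. h x * exp (u x)))"
  unfolding J_functional_def vint_diff vint_cmult vint_grad_norm_sq[OF assms]
  by (simp add: power2_eq_square)

text \<open>
  Equality of \<open>u\<close> across every edge propagates along paths, so connectedness enters here.
\<close>

lemma dirichlet_form_eq_0_imp_constant:
  assumes graph: "weighted_graph E w \<mu>" and "dirichlet_form E w u u = 0"
  shows "u x = u y"
proof -
  have w_pos: "0 < w a b" if "(a, b) \<in> E" for a b
    using graph that by (simp add: weighted_graph_def)
  have nn: "0 \<le> (\<Sum>b | (a, b) \<in> E. w a b * ((u b - u a) * (u b - u a)))" for a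
    using w_pos by (intro sum_nonneg) (auto simp: less_imp_le)
  have inner: "(\<Sum>b | (a, b) \<in> E. w a b * ((u b - u a) * (u b - u a))) = 0" for a
    using assms(2) nn unfolding dirichlet_form_def by (simp add: sum_nonneg_eq_0_iff)
  have edge: "u a = u b" if "(a, b) \<in> E" for a b
  proof -
    have "\<forall>b\<in>{b. (a, b) \<in> E}. w a b * ((u b - u a) * (u b - u a)) = 0"
      using inner[of a] w_pos by (subst (asm) sum_nonneg_eq_0_iff) (auto simp: less_imp_le)
    with that w_pos[OF that] show ?thesis by auto
  qed
  have "(x, y) \<in> E\<^sup>*"
    using graph by (simp add: weighted_graph_def)
  then show ?thesis
    by (induction rule: rtrancl_induct) (auto dest: edge)
qed

section \<open>Minimizers of functionals on a finite vertex set\<close>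

text \<open>
  The bounded sublevel set lies in a cube \<open>[-R, R]\<^sup>V\<close>, which is compact by
  Tychonoff's theorem.
\<close>

lemma continuous_attains_inf_bounded_sublevel:
  fixes f :: "('v::finite \<Rightarrow> real) \<Rightarrow> real"
  assumes "closed S" and z: "z \<in> S" and "continuous_on S f"
    and bound: "\<And>u x. u \<in> S \<Longrightarrow> f u \<le> f z \<Longrightarrow> \<bar>u x\<bar> \<le> R"
  obtains u where "u \<in> S" "\<And>v. v \<in> S \<Longrightarrow> f u \<le> f v"
proof -
  let ?K = "PiE UNIV (\<lambda>_::'v. {- R..R})"
  have "compactin (product_topology (\<lambda>_. euclidean) UNIV) ?K"
    by (subst compactin_PiE) auto
  then have "compact ?K"
    by (simp add: euclidean_product_topology)
  then have "compact (S \<inter> ?K)"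
    using \<open>closed S\<close> by (rule closed_Int_compact[rotated])
  moreover have z_K: "z \<in> S \<inter> ?K"
    using z bound[OF z order_refl] by (auto simp: abs_le_iff minus_le_iff)
  moreover have "continuous_on (S \<inter> ?K) f"
    using assms(3) by (rule continuous_on_subset) auto
  ultimately obtain u where u: "u \<in> S \<inter> ?K" and min: "\<And>v. v \<in> S \<inter> ?K \<Longrightarrow> f u \<le> f v"
    using continuous_attains_inf[of "S \<inter> ?K" f] by blast
  have "f u \<le> f v" if "v \<in> S" for v
  proof (cases "f v \<le> f z")
    case True
    then have "v \<in> ?K"
      using bound[OF that True] by (auto simp: abs_le_iff minus_le_iff)
    with that show ?thesis by (intro min) auto
  next
    case False
    with min[OF z_K] show ?thesis by linarith
  qed
  with u show ?thesis by (intro that[of u]) auto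
qed

lemma continuous_on_coordinate: "continuous_on S (\<lambda>u::'v \<Rightarrow> real. u x)"
  by (rule continuous_on_subset[OF continuous_on_product_coordinates]) simp

lemma continuous_on_vint:
  "(\<And>x. continuous_on S (\<lambda>u. f u x)) \<Longrightarrow> continuous_on S (\<lambda>u. vint \<mu> (f u))"
  unfolding vint_def by (intro continuous_intros)

lemma continuous_on_dirichlet_form: "continuous_on S (\<lambda>u. dirichlet_form E w u u)"
  unfolding dirichlet_form_def by (intro continuous_intros continuous_on_coordinate)

lemma continuous_on_J_functional:
  assumes graph: "weighted_graph E w \<mu>" and h: "\<And>x. 0 < h x"
  shows "continuous_on S (J_functional E w \<mu> h \<alpha> \<beta>)"
proof -
  have "0 < vint \<mu> (\<lambda>x. h x * exp (u x))" for u
    using h weighted_graph_measure_pos[OF graph] by (intro vint_pos) auto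
  then have "vint \<mu> (\<lambda>x. h x * exp (u x)) \<noteq> 0" for u
    by (metis less_irrefl)
  then show ?thesis
    unfolding J_functional_eq[OF graph, abs_def]
    by (intro continuous_intros continuous_on_dirichlet_form continuous_on_vint
        continuous_on_coordinate) auto
qed

text \<open>
  A maximum point of \<open>|u|\<close> makes the two competing terms comparable: \<open>\<integral>u\<^sup>2\<close> is at least a multiple of
  \<open>max |u|\<^sup>2\<close>.
\<close>

lemma obtain_max_abs:
  fixes \<mu> u :: "'v::finite \<Rightarrow> real"
  assumes pos: "\<And>x. 0 < \<mu> x"
  obtains L where "0 \<le> L" "\<And>x. \<bar>u x\<bar> \<le> L" "Min (range \<mu>) * L\<^sup>2 \<le> ip \<mu> u u"
proof -
  let ?L = "Max (range (\<lambda>x. \<bar>u x\<bar>))"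
  have le: "\<bar>u x\<bar> \<le> ?L" for x by (intro Max_ge) auto
  have "?L \<in> range (\<lambda>x. \<bar>u x\<bar>)" by (intro Max_in) auto
  then obtain a where a: "?L = \<bar>u a\<bar>" by (rule imageE)
  have "Min (range \<mu>) * ?L\<^sup>2 \<le> \<mu> a * ?L\<^sup>2"
    by (intro mult_right_mono Min_le) auto
  also have "\<dots> = \<mu> a * (u a * u a)"
    unfolding a by (simp add: power2_eq_square)
  also have "\<dots> \<le> ip \<mu> u u"
    unfolding vint_def
    by (rule member_le_sum[of a UNIV "\<lambda>x. \<mu> x * (u x * u x)"]) (auto simp: less_imp_le[OF pos])
  finally have "Min (range \<mu>) * ?L\<^sup>2 \<le> ip \<mu> u u" .
  moreover have "0 \<le> ?L" using a by simp
  ultimately show ?thesis using le that by blast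
qed

lemma Min_measure_pos:
  fixes \<mu> :: "'v::finite \<Rightarrow> real"
  assumes "\<And>x. 0 < \<mu> x"
  shows "0 < Min (range \<mu>)"
  using assms by (subst Min_gr_iff) auto

text \<open>
  The integral \<open>\<integral>h e\<^sup>u\<close> lies between \<open>e\<^sup>-\<^sup>L \<integral>h\<close> and \<open>e\<^sup>L \<integral>h\<close>. Both bounds are needed because \<open>\<beta>\<close> may
  have either sign.
\<close>

lemma abs_ln_partition_le:
  assumes \<mu>: "\<And>x. 0 < \<mu> x" and h: "\<And>x. 0 < h x" and L: "\<And>x. \<bar>u x\<bar> \<le> L"
  shows "\<bar>ln (vint \<mu> (\<lambda>x. h x * exp (u x)))\<bar> \<le> \<bar>ln (vint \<mu> h)\<bar> + L"
proof -
  let ?Z = "vint \<mu> (\<lambda>x. h x * exp (u x))"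
  have pos: "0 < vint \<mu> h" "0 < ?Z"
    using \<mu> h by (auto intro: vint_pos)
  have "exp (- L) \<le> exp (u x)" "exp (u x) \<le> exp L" for x
    using L[of x] by (auto simp: abs_le_iff)
  then have "exp (- L) * vint \<mu> h \<le> ?Z" "?Z \<le> exp L * vint \<mu> h"
    unfolding vint_cmult[symmetric] unfolding vint_def
    using less_imp_le[OF \<mu>] less_imp_le[OF h]
    by (auto intro!: sum_mono mult_left_mono simp: mult.commute[of "exp _"])
  then have "ln (exp (- L) * vint \<mu> h) \<le> ln ?Z" "ln ?Z \<le> ln (exp L * vint \<mu> h)"
    using pos by auto
  then show ?thesis
    using pos by (simp add: ln_mult)
qed

text \<open>
  The first variation is formulated for the whole functional; with \<open>\<beta> = 0\<close> it is also the
  Euler-Lagrange equation of the Rayleigh quotient.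
\<close>

lemma first_variation:
  assumes graph: "weighted_graph E w \<mu>" and h: "\<And>x. 0 < h x"
    and min: "\<And>t. J_functional E w \<mu> h \<alpha> \<beta> u \<le> J_functional E w \<mu> h \<alpha> \<beta> (\<lambda>x. u x + t * v x)"
  shows "dirichlet_form E w u v - \<alpha> * ip \<mu> u v =
    \<beta> * vint \<mu> (\<lambda>x. h x * v x * exp (u x)) / vint \<mu> (\<lambda>x. h x * exp (u x))"
    (is "?q = \<beta> * ?N / ?Z")
proof -
  let ?D = "dirichlet_form E w"
  define q where "q t = 1 / 2 * ((?D u u + 2 * t * ?D u v + t\<^sup>2 * ?D v v)
      - \<alpha> * (ip \<mu> u u + 2 * t * ip \<mu> u v + t\<^sup>2 * ip \<mu> v v))" for t
  define Z where "Z t = (\<Sum>x\<in>UNIV. \<mu> x * (h x * exp (u x + t * v x)))" for t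
  have f: "q t - \<beta> * ln (Z t) = J_functional E w \<mu> h \<alpha> \<beta> (\<lambda>x. u x + t * v x)" for t
    unfolding q_def Z_def J_functional_eq[OF graph] dirichlet_form_add_scaled ip_add_scaled
    by (simp add: vint_def)
  have "0 < Z 0"
    unfolding Z_def using h weighted_graph_measure_pos[OF graph] by (intro sum_pos) auto
  have q': "(q has_real_derivative ?q) (at 0)"
    unfolding q_def[abs_def] by (auto intro!: derivative_eq_intros)
  have "((\<lambda>t. \<mu> x * (h x * exp (u x + t * v x))) has_real_derivative
      \<mu> x * (h x * v x * exp (u x))) (at 0)" for x
    by (auto intro!: derivative_eq_intros)
  then have "(Z has_real_derivative ?N) (at 0)"
    unfolding Z_def[abs_def] vint_def by (intro DERIV_sum)
  with DERIV_ln_divide[OF \<open>0 < Z 0\<close>]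
  have "((\<lambda>t. ln (Z t)) has_real_derivative 1 / Z 0 * ?N) (at 0)"
    by (rule DERIV_chain2)
  from DERIV_diff[OF q' DERIV_cmult[OF this, of \<beta>]]
  have "((\<lambda>t. q t - \<beta> * ln (Z t)) has_real_derivative (?q - \<beta> * ?N / ?Z)) (at 0)"
    by (simp add: Z_def vint_def)
  then have "?q - \<beta> * ?N / ?Z = 0"
    by (rule DERIV_local_min[where d = 1]) (use min in \<open>auto simp: f\<close>)
  then show ?thesis by simp
qed

section \<open>The orthogonal complement of the low eigenspaces\<close>

lemma eigenspace_zero: "(\<lambda>x. 0) \<in> eigenspace E w \<mu> l"
  by (simp add: eigenspace_def laplacian_def)

lemma laplacian_eigenfunction:
  "v \<in> eigenspace E w \<mu> l \<Longrightarrow> laplacian E w \<mu> v = (\<lambda>x. - l * v x)"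
  by (auto simp: eigenspace_def minus_equation_iff[of "laplacian _ _ _ _ _"] fun_eq_iff)

lemma constant_in_eigenspace_0: "(\<lambda>x. c) \<in> eigenspace E w \<mu> 0"
  by (simp add: eigenspace_def laplacian_def)

lemma ip_laplacian_eigenfunction:
  assumes "weighted_graph E w \<mu>" "v \<in> eigenspace E w \<mu> l"
  shows "ip \<mu> (laplacian E w \<mu> u) v = - l * ip \<mu> u v"
  unfolding laplacian_self_adjoint[OF assms(1)] laplacian_eigenfunction[OF assms(2)]
  by (simp add: vint_cmult[symmetric] mult.left_commute)

lemma eigenspaces_orthogonal:
  assumes "weighted_graph E w \<mu>" "u \<in> eigenspace E w \<mu> l" "v \<in> eigenspace E w \<mu> l'" "l \<noteq> l'"
  shows "ip \<mu> u v = 0"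
proof -
  have "- l * ip \<mu> u v = - l' * ip \<mu> u v"
    using ip_laplacian_eigenfunction[OF assms(1,3), of u]
    unfolding laplacian_eigenfunction[OF assms(2)]
    by (simp add: vint_cmult[symmetric] mult.assoc)
  with assms(4) show ?thesis by simp
qed

lemma vint_laplacian:
  assumes "weighted_graph E w \<mu>"
  shows "vint \<mu> (laplacian E w \<mu> u) = 0"
  using ip_laplacian_eigenfunction[OF assms constant_in_eigenspace_0[of 1], of u] by simp

lemma E_perp_iff:
  "u \<in> E_perp E w \<mu> lam k \<longleftrightarrow>
     vint \<mu> u = 0 \<and> (\<forall>s\<in>{1..k}. \<forall>v\<in>eigenspace E w \<mu> (lam s). ip \<mu> u v = 0)"
    (is "_ \<longleftrightarrow> _ \<and> ?orth")
proof -
  have "(\<forall>v\<in>E_sum E w \<mu> lam k. ip \<mu> u v = 0) \<longleftrightarrow> ?orth"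
  proof (intro iffI ballI)
    fix s v
    assume all: "\<forall>v\<in>E_sum E w \<mu> lam k. ip \<mu> u v = 0"
      and s: "s \<in> {1..k}" and v: "v \<in> eigenspace E w \<mu> (lam s)"
    have "(\<lambda>x. \<Sum>r=1..k. (if r = s then v else (\<lambda>_. 0)) x) \<in> E_sum E w \<mu> lam k"
      unfolding E_sum_def using v eigenspace_zero[of E w \<mu>]
      by (intro CollectI exI[of _ "\<lambda>r. if r = s then v else (\<lambda>_. 0)"]) auto
    moreover have "(\<lambda>x. \<Sum>r=1..k. (if r = s then v else (\<lambda>_. 0)) x) = v"
      using s by (auto simp: if_distrib[of "\<lambda>f. f _"] sum.delta)
    ultimately show "ip \<mu> u v = 0" using all by auto
  next
    fix v
    assume orth: ?orth and "v \<in> E_sum E w \<mu> lam k"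
    then obtain f where f: "\<forall>s\<in>{1..k}. f s \<in> eigenspace E w \<mu> (lam s)"
      and v: "v = (\<lambda>x. \<Sum>s=1..k. f s x)"
      by (auto simp: E_sum_def)
    have "ip \<mu> u v = (\<Sum>s=1..k. ip \<mu> u (f s))"
      unfolding v sum_distrib_left by (rule vint_sum)
    also have "\<dots> = 0"
      using orth f by (intro sum.neutral) auto
    finally show "ip \<mu> u v = 0" .
  qed
  then show ?thesis by (simp add: E_perp_def H_space_def)
qed

lemma E_perp_zero: "(\<lambda>x. 0) \<in> E_perp E w \<mu> lam k"
  by (simp add: E_perp_iff vint_def)

lemma E_perp_scaled:
  "u \<in> E_perp E w \<mu> lam k \<Longrightarrow> (\<lambda>x. c * u x) \<in> E_perp E w \<mu> lam k"
  by (simp add: E_perp_iff vint_cmult mult.assoc)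

lemma E_perp_add:
  "u \<in> E_perp E w \<mu> lam k \<Longrightarrow> v \<in> E_perp E w \<mu> lam k \<Longrightarrow>
    (\<lambda>x. u x + v x) \<in> E_perp E w \<mu> lam k"
  by (simp add: E_perp_iff vint_add distrib_right)

text \<open>
  This invariance, due to self-adjointness, turns the constrained Euler-Lagrange equation of the
  Rayleigh quotient into a genuine eigenvalue equation: its residual cannot leave \<open>E_perp\<close>.
\<close>

lemma E_perp_laplacian:
  assumes "weighted_graph E w \<mu>" "u \<in> E_perp E w \<mu> lam k"
  shows "laplacian E w \<mu> u \<in> E_perp E w \<mu> lam k"
  using assms(2)
  by (simp add: E_perp_iff vint_laplacian[OF assms(1)] ip_laplacian_eigenfunction[OF assms(1)])

lemma closed_E_perp: "closed (E_perp E w \<mu> lam k)"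
proof -
  have "E_perp E w \<mu> lam k = {u. vint \<mu> u = 0} \<inter>
      (\<Inter>s\<in>{1..k}. \<Inter>v\<in>eigenspace E w \<mu> (lam s). {u. ip \<mu> u v = 0})"
    by (auto simp: E_perp_iff)
  also have "closed \<dots>"
    by (intro closed_Int closed_INT ballI closed_Collect_eq continuous_on_vint continuous_intros
        continuous_on_coordinate)
  finally show ?thesis .
qed

section \<open>The spectral gap and coercivity\<close>

lemma rayleigh_minimizer_eigenfunction:
  assumes graph: "weighted_graph E w \<mu>" and u: "u \<in> E_perp E w \<mu> lam k"
    and eq: "dirichlet_form E w u u = l * ip \<mu> u u"
    and min: "\<And>v. v \<in> E_perp E w \<mu> lam k \<Longrightarrow> l * ip \<mu> v v \<le> dirichlet_form E w v v"
  shows "u \<in> eigenspace E w \<mu> l"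
proof -
  \<comment> \<open>The residual of the eigenvalue equation is itself an admissible direction of variation.\<close>
  define v where "v = (\<lambda>x. laplacian E w \<mu> u x + l * u x)"
  have v: "v \<in> E_perp E w \<mu> lam k"
    unfolding v_def by (intro E_perp_add E_perp_scaled E_perp_laplacian[OF graph] u)
  have "dirichlet_form E w u v - l * ip \<mu> u v =
      0 * vint \<mu> (\<lambda>x. 1 * v x * exp (u x)) / vint \<mu> (\<lambda>x. 1 * exp (u x))"
  proof (rule first_variation[OF graph])
    fix t
    have "(\<lambda>x. u x + t * v x) \<in> E_perp E w \<mu> lam k"
      by (intro E_perp_add E_perp_scaled u v)
    from min[OF this] show "J_functional E w \<mu> (\<lambda>x. 1) l 0 u
        \<le> J_functional E w \<mu> (\<lambda>x. 1) l 0 (\<lambda>x. u x + t * v x)"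
      by (simp add: J_functional_eq[OF graph] eq)
  qed simp
  moreover have "ip \<mu> v v = ip \<mu> (laplacian E w \<mu> u) v + l * ip \<mu> u v"
    by (subst (1) v_def) (simp add: distrib_right vint_add vint_cmult mult.assoc)
  ultimately have "ip \<mu> v v = 0"
    by (simp add: green_formula[OF graph])
  then have "v x = 0" for x
    using ip_self_eq_0D weighted_graph_measure_pos[OF graph] by blast
  then have "laplacian E w \<mu> u x + l * u x = 0" for x
    by (simp add: v_def)
  then have "- laplacian E w \<mu> u x = l * u x" for x
    by (metis minus_unique)
  then show ?thesis
    by (simp add: eigenspace_def)
qed

text \<open>
  The unit sphere of \<open>E_perp\<close> is compact, and the quotient is homogeneous of degree 0, so the minimum on
  the sphere bounds the Dirichlet form on all of \<open>E_perp\<close>.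
\<close>

lemma obtain_rayleigh_minimizer:
  assumes graph: "weighted_graph E w \<mu>" and z: "z \<in> E_perp E w \<mu> lam k" "ip \<mu> z z \<noteq> 0"
  obtains u l where "u \<in> E_perp E w \<mu> lam k" "ip \<mu> u u = 1" "dirichlet_form E w u u = l"
    "\<And>v. v \<in> E_perp E w \<mu> lam k \<Longrightarrow> l * ip \<mu> v v \<le> dirichlet_form E w v v"
proof -
  let ?P = "E_perp E w \<mu> lam k" and ?D = "\<lambda>u. dirichlet_form E w u u"
  let ?S = "?P \<inter> {u. ip \<mu> u u = 1}"
  note pos = weighted_graph_measure_pos[OF graph]
  have normalize: "(\<lambda>x. 1 / sqrt (ip \<mu> v v) * v x) \<in> ?S \<and>
      ?D (\<lambda>x. 1 / sqrt (ip \<mu> v v) * v x) = ?D v / ip \<mu> v v"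
    if v: "v \<in> ?P" "ip \<mu> v v \<noteq> 0" for v
  proof -
    let ?c = "1 / sqrt (ip \<mu> v v)"
    have c: "?c\<^sup>2 = 1 / ip \<mu> v v"
      using ip_self_nonneg[of \<mu> v] pos by (simp add: power_divide)
    have "ip \<mu> (\<lambda>x. ?c * v x) (\<lambda>x. ?c * v x) = ?c\<^sup>2 * ip \<mu> v v"
      unfolding vint_cmult[symmetric] by (simp add: power2_eq_square algebra_simps)
    with v c have "ip \<mu> (\<lambda>x. ?c * v x) (\<lambda>x. ?c * v x) = 1"
      by simp
    moreover have "(\<lambda>x. ?c * v x) \<in> ?P"
      by (rule E_perp_scaled[OF v(1)])
    moreover have "?D (\<lambda>x. ?c * v x) = ?D v / ip \<mu> v v"
      unfolding dirichlet_form_scaled c by simp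
    ultimately show ?thesis by blast
  qed
  have "closed ?S"
    by (intro closed_Int closed_E_perp closed_Collect_eq continuous_on_vint continuous_intros
        continuous_on_coordinate)
  moreover have "\<bar>u x\<bar> \<le> 1 / Min (range \<mu>) + 1" if "u \<in> ?S" for u x
  proof -
    obtain L where L: "0 \<le> L" "\<And>x. \<bar>u x\<bar> \<le> L" "Min (range \<mu>) * L\<^sup>2 \<le> ip \<mu> u u"
      using obtain_max_abs[of \<mu> u, OF pos] by blast
    have "L\<^sup>2 \<le> 1 / Min (range \<mu>)"
      using L(3) that Min_measure_pos[of \<mu>] pos by (simp add: field_simps)
    moreover have "L \<le> L\<^sup>2 + 1"
      using zero_le_power2[of "L - 1"] L(1) by (simp add: power2_eq_square algebra_simps)
    ultimately show ?thesis using L(2)[of x] by linarith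
  qed
  ultimately obtain u where u: "u \<in> ?S" and min: "\<And>v. v \<in> ?S \<Longrightarrow> ?D u \<le> ?D v"
    using continuous_attains_inf_bounded_sublevel[of ?S, OF _ conjunct1[OF normalize[OF z]]
        continuous_on_dirichlet_form, of E w "1 / Min (range \<mu>) + 1"]
    by blast
  have "?D u * ip \<mu> v v \<le> ?D v" if v: "v \<in> ?P" for v
  proof (cases "ip \<mu> v v = 0")
    case True
    then have "v = (\<lambda>x. 0)"
      using ip_self_eq_0D pos by blast
    then show ?thesis by (simp add: vint_def dirichlet_form_def)
  next
    case False
    then have "0 < ip \<mu> v v"
      using ip_self_nonneg[of \<mu> v] pos by fastforce
    moreover have "?D u \<le> ?D v / ip \<mu> v v"
      using min[OF conjunct1[OF normalize[OF v False]]] conjunct2[OF normalize[OF v False]]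
      by (rule ord_le_eq_trans)
    ultimately show ?thesis by (simp add: pos_le_divide_eq)
  qed
  with u show ?thesis by (intro that[of u "?D u"]) auto
qed

text \<open>
  The minimum of the Rayleigh quotient is a non-zero eigenvalue other than \<open>lam 1, \<dots>, lam k\<close>, hence
  one of those that \<open>\<Lambda>\<close> bounds from below.
\<close>

lemma spectral_gap:
  assumes graph: "weighted_graph E w \<mu>"
    and gap: "\<And>l. l \<noteq> 0 \<Longrightarrow> eigenvalue E w \<mu> l \<Longrightarrow> l \<notin> lam ` {1..k} \<Longrightarrow> \<Lambda> \<le> l"
    and v: "v \<in> E_perp E w \<mu> lam k"
  shows "\<Lambda> * ip \<mu> v v \<le> dirichlet_form E w v v"
proof (cases "ip \<mu> v v = 0")
  case True
  then have "v = (\<lambda>x. 0)"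
    using ip_self_eq_0D weighted_graph_measure_pos[OF graph] by blast
  then show ?thesis by (simp add: vint_def dirichlet_form_def)
next
  case False
  note pos = weighted_graph_measure_pos[OF graph]
  obtain u l where u: "u \<in> E_perp E w \<mu> lam k" "ip \<mu> u u = 1" "dirichlet_form E w u u = l"
    and min: "\<And>v. v \<in> E_perp E w \<mu> lam k \<Longrightarrow> l * ip \<mu> v v \<le> dirichlet_form E w v v"
    using obtain_rayleigh_minimizer[OF graph v False] by blast
  have eig: "u \<in> eigenspace E w \<mu> l"
    using rayleigh_minimizer_eigenfunction[OF graph u(1) _ min] u by simp
  have "\<exists>x. u x \<noteq> 0"
    using u(2) by (auto simp: vint_def intro: ccontr)
  then have "eigenvalue E w \<mu> l"
    using eig by (auto simp: eigenvalue_def)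
  moreover have "l \<noteq> 0"
  proof
    assume "l = 0"
    then have const: "u x = u y" for x y
      using dirichlet_form_eq_0_imp_constant[OF graph] u(3) by blast
    obtain a where a: "u a \<noteq> 0" using \<open>\<exists>x. u x \<noteq> 0\<close> by blast
    have "\<mu> x * u x = u a * (\<mu> x * 1)" for x
      using const[of x a] by simp
    then have "vint \<mu> u = u a * vint \<mu> (\<lambda>x. 1)"
      unfolding vint_def sum_distrib_left by (intro sum.cong refl)
    moreover have "0 < vint \<mu> (\<lambda>x. 1)"
      using pos by (intro vint_pos) auto
    ultimately show False
      using a u(1) by (simp add: E_perp_iff)
  qed
  moreover have "l \<notin> lam ` {1..k}"
    using u(1,2) eig by (auto simp: E_perp_iff)
  ultimately have "\<Lambda> \<le> l" by (intro gap)
  then have "\<Lambda> * ip \<mu> v v \<le> l * ip \<mu> v v"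
    using ip_self_nonneg[of \<mu> v] pos by (intro mult_right_mono) auto
  also note min[OF v]
  finally show ?thesis .
qed

text \<open>
  On a sublevel set, \<open>L = max |u|\<close> satisfies \<open>a L\<^sup>2 \<le> c + |\<beta>| L\<close>, where \<open>a > 0\<close> is the size of the gap
  \<open>\<Lambda> - \<alpha>\<close> up to a factor that depends on \<open>\<mu>\<close>; this keeps \<open>L\<close> bounded.
\<close>

lemma J_coercive:
  assumes graph: "weighted_graph E w \<mu>" and h: "\<And>x. 0 < h x" and "\<alpha> < \<Lambda>"
    and gap: "\<And>v. v \<in> S \<Longrightarrow> \<Lambda> * ip \<mu> v v \<le> dirichlet_form E w v v"
  obtains R where "\<And>u x. u \<in> S \<Longrightarrow> J_functional E w \<mu> h \<alpha> \<beta> u \<le> M \<Longrightarrow> \<bar>u x\<bar> \<le> R"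
proof -
  note pos = weighted_graph_measure_pos[OF graph]
  define a where "a = (\<Lambda> - \<alpha>) / 2 * Min (range \<mu>)"
  define c where "c = \<bar>M\<bar> + \<bar>\<beta>\<bar> * \<bar>ln (vint \<mu> h)\<bar>"
  have a: "0 < a"
    using \<open>\<alpha> < \<Lambda>\<close> Min_measure_pos[of \<mu>] pos by (simp add: a_def)
  have "\<bar>u x\<bar> \<le> (c + \<bar>\<beta>\<bar>) / a + 1" if u: "u \<in> S" and J: "J_functional E w \<mu> h \<alpha> \<beta> u \<le> M" for u x
  proof -
    obtain L where L: "0 \<le> L" "\<And>x. \<bar>u x\<bar> \<le> L" "Min (range \<mu>) * L\<^sup>2 \<le> ip \<mu> u u"
      using obtain_max_abs[of \<mu> u, OF pos] by blast
    let ?Z = "vint \<mu> (\<lambda>x. h x * exp (u x))"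
    have "\<beta> * ln ?Z \<le> \<bar>\<beta>\<bar> * \<bar>ln ?Z\<bar>"
      by (metis abs_ge_self abs_mult)
    also have "\<dots> \<le> \<bar>\<beta>\<bar> * (\<bar>ln (vint \<mu> h)\<bar> + L)"
      using abs_ln_partition_le[OF pos h L(2)] by (intro mult_left_mono) auto
    finally have ln: "\<beta> * ln ?Z \<le> \<bar>\<beta>\<bar> * \<bar>ln (vint \<mu> h)\<bar> + \<bar>\<beta>\<bar> * L"
      by (simp add: distrib_left)
    have "a * L\<^sup>2 = (\<Lambda> - \<alpha>) / 2 * (Min (range \<mu>) * L\<^sup>2)"
      by (simp add: a_def)
    also have "\<dots> \<le> (\<Lambda> - \<alpha>) / 2 * ip \<mu> u u"
      using L(3) \<open>\<alpha> < \<Lambda>\<close> by (intro mult_left_mono) auto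
    also have "\<dots> = 1 / 2 * (\<Lambda> * ip \<mu> u u - \<alpha> * ip \<mu> u u)"
      by (simp add: left_diff_distrib)
    also have "\<dots> \<le> 1 / 2 * (dirichlet_form E w u u - \<alpha> * ip \<mu> u u)"
      using gap[OF u] by simp
    also have "\<dots> \<le> M + \<beta> * ln ?Z"
      using J unfolding J_functional_eq[OF graph] by linarith
    also have "\<dots> \<le> c + \<bar>\<beta>\<bar> * L"
      using ln by (simp add: c_def)
    finally have quad: "a * L\<^sup>2 \<le> c + \<bar>\<beta>\<bar> * L" .
    have c: "0 \<le> c" by (simp add: c_def)
    \<comment> \<open>For \<open>L > 1\<close> the right-hand side is at most \<open>(c + |\<beta>|) L\<close>, and \<open>L\<close> cancels.\<close>
    have "L \<le> (c + \<bar>\<beta>\<bar>) / a + 1"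
    proof (cases "L \<le> 1")
      case True
      have "0 \<le> (c + \<bar>\<beta>\<bar>) / a"
        using a c by simp
      with True show ?thesis by linarith
    next
      case False
      then have "c \<le> c * L"
        using c by (simp add: mult_le_cancel_left1)
      with quad have "(a * L) * L \<le> (c + \<bar>\<beta>\<bar>) * L"
        by (simp add: algebra_simps power2_eq_square)
      with False have "a * L \<le> c + \<bar>\<beta>\<bar>"
        by (simp add: mult_le_cancel_right)
      with a have "L \<le> (c + \<bar>\<beta>\<bar>) / a"
        by (simp add: pos_le_divide_eq mult.commute)
      then show ?thesis by linarith
    qed
    with L(2)[of x] show ?thesis by linarith
  qed
  then show ?thesis by (rule that)
qed

section \<open>The Kazdan-Warner equation\<close>

text \<open>
  The bases of distinct eigenspaces together form one orthonormal family, because self-adjointness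
  makes these eigenspaces orthogonal to each other.
\<close>

lemma ip_orthonormal_expansion:
  fixes k :: nat
  assumes graph: "weighted_graph E w \<mu>"
    and inj: "inj_on lam {1..k}"
    and basis: "\<And>s. s \<in> {1..k} \<Longrightarrow> orthonormal_basis \<mu> (eigenspace E w \<mu> (lam s)) (n s) (U s)"
    and t: "t \<in> {1..k}" "j \<in> {1..n t}"
  shows "ip \<mu> (\<lambda>x. \<Sum>s=1..k. \<Sum>i=1..n s. c s i * U s i x) (U t j) = c t j"
proof -
  have U: "ip \<mu> (U s i) (U t j) = (if s = t \<and> i = j then 1 else 0)"
    if "s \<in> {1..k}" "i \<in> {1..n s}" for s i
  proof (cases "s = t")
    case True
    with basis[OF t(1)] t that show ?thesis by (auto simp: orthonormal_basis_def)
  next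
    case False
    then have "lam s \<noteq> lam t"
      using inj that t by (auto dest: inj_onD)
    moreover have "U s i \<in> eigenspace E w \<mu> (lam s)" "U t j \<in> eigenspace E w \<mu> (lam t)"
      using basis that t by (auto simp: orthonormal_basis_def)
    ultimately show ?thesis
      using eigenspaces_orthogonal[OF graph] False by auto
  qed
  have "ip \<mu> (\<lambda>x. \<Sum>s=1..k. \<Sum>i=1..n s. c s i * U s i x) (U t j) =
      (\<Sum>s=1..k. \<Sum>i=1..n s. c s i * ip \<mu> (U s i) (U t j))"
    unfolding sum_distrib_right vint_sum vint_cmult mult.assoc ..
  also have "\<dots> = (\<Sum>s=1..k. \<Sum>i=1..n s. if i = j then (if s = t then c s i else 0) else 0)"
    by (intro sum.cong refl) (simp add: U)
  also have "\<dots> = (\<Sum>s=1..k. if s = t then c t j else 0)"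
    using t by (intro sum.cong refl) (auto simp: sum.delta)
  also have "\<dots> = c t j"
    using t by simp
  finally show ?thesis .
qed

text \<open>Orthogonality to the eigenspaces has to be tested on their bases only.\<close>

lemma E_perpI_basis:
  assumes basis: "\<And>s. s \<in> {1..k} \<Longrightarrow> orthonormal_basis \<mu> (eigenspace E w \<mu> (lam s)) (n s) (U s)"
    and "vint \<mu> u = 0"
    and orth: "\<And>s i. s \<in> {1..k} \<Longrightarrow> i \<in> {1..n s} \<Longrightarrow> ip \<mu> u (U s i) = 0"
  shows "u \<in> E_perp E w \<mu> lam k"
proof -
  have "ip \<mu> u v = 0" if s: "s \<in> {1..k}" and v: "v \<in> eigenspace E w \<mu> (lam s)" for s v
  proof -
    from basis[OF s] v obtain c where "\<And>x. v x = (\<Sum>i=1..n s. c i * U s i x)"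
      by (auto simp: orthonormal_basis_def)
    then have "ip \<mu> u v = (\<Sum>i=1..n s. c i * ip \<mu> u (U s i))"
      by (simp add: sum_distrib_left vint_sum vint_cmult[symmetric] mult.left_commute)
    with orth[OF s] show ?thesis by simp
  qed
  with assms(2) show ?thesis by (simp add: E_perp_iff)
qed

text \<open>
  Below, \<open>g\<close> is \<open>h e\<^sup>u\<close> normalized to integral 1, \<open>\<beta> / Vol \<mu>\<close> and \<open>p\<close> are the projections of \<open>\<beta> g\<close> onto the
  constants and onto \<open>E_sum\<close>, and \<open>R\<close> is the residual of the equation. The two projections are
  the Lagrange multipliers of the constraints that define \<open>E_perp\<close>, so \<open>R\<close> satisfies these
  constraints and is an admissible direction of variation.
\<close>

lemma critical_point_solves_kazdan_warner:
  assumes graph: "weighted_graph E w \<mu>" and h: "\<And>x. 0 < h x"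
    and inj: "inj_on lam {1..k}" and nz: "0 \<notin> lam ` {1..k}"
    and basis: "\<And>s. s \<in> {1..k} \<Longrightarrow> orthonormal_basis \<mu> (eigenspace E w \<mu> (lam s)) (n s) (U s)"
    and u: "u \<in> E_perp E w \<mu> lam k"
    and min: "\<And>v. v \<in> E_perp E w \<mu> lam k \<Longrightarrow>
      J_functional E w \<mu> h \<alpha> \<beta> u \<le> J_functional E w \<mu> h \<alpha> \<beta> v"
  shows "laplacian E w \<mu> u x + \<alpha> * u x =
      - (\<beta> * h x * exp (u x)) / vint \<mu> (\<lambda>y. h y * exp (u y))
      + \<beta> / Vol \<mu>
      + (\<Sum>s=1..k. \<Sum>i=1..n s.
           \<beta> * vint \<mu> (\<lambda>y. h y * U s i y * exp (u y))
             / vint \<mu> (\<lambda>y. h y * exp (u y)) * U s i x)"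
proof -
  note pos = weighted_graph_measure_pos[OF graph]
  define Z where "Z = vint \<mu> (\<lambda>y. h y * exp (u y))"
  define g where "g = (\<lambda>x. h x * exp (u x) / Z)"
  define p where "p = (\<lambda>x. \<Sum>s=1..k. \<Sum>i=1..n s. \<beta> * ip \<mu> g (U s i) * U s i x)"
  define R where "R = (\<lambda>x. laplacian E w \<mu> u x + \<alpha> * u x + \<beta> * g x - \<beta> / Vol \<mu> * 1 - p x)"
  have Z: "0 < Z"
    unfolding Z_def using pos h by (intro vint_pos) auto
  have Vol: "0 < Vol \<mu>"
    unfolding Vol_def using pos by (intro sum_pos) auto
  have one: "vint \<mu> (\<lambda>x. 1) = Vol \<mu>"
    by (simp add: vint_def Vol_def)
  have g_int: "vint \<mu> (\<lambda>x. g x * f x) = vint \<mu> (\<lambda>x. h x * f x * exp (u x)) / Z" for f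
    unfolding g_def vint_def by (simp add: sum_divide_distrib algebra_simps)
  have g_mass: "vint \<mu> g = 1"
    using g_int[of "\<lambda>_. 1"] Z by (simp add: Z_def)
  have U_eig: "U s i \<in> eigenspace E w \<mu> (lam s)" if "s \<in> {1..k}" "i \<in> {1..n s}" for s i
    using basis that by (auto simp: orthonormal_basis_def)
  have U_mean: "vint \<mu> (U s i) = 0" if "s \<in> {1..k}" "i \<in> {1..n s}" for s i
  proof -
    have "lam s \<noteq> 0" using nz that by auto
    with eigenspaces_orthogonal[OF graph U_eig[OF that] constant_in_eigenspace_0[of 1]]
    show ?thesis by simp
  qed
  have u_perp: "vint \<mu> u = 0"
    "\<And>s v. s \<in> {1..k} \<Longrightarrow> v \<in> eigenspace E w \<mu> (lam s) \<Longrightarrow> ip \<mu> u v = 0"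
    using u by (auto simp: E_perp_iff)
  have R_ip: "ip \<mu> R v = ip \<mu> (laplacian E w \<mu> u) v + \<alpha> * ip \<mu> u v + \<beta> * ip \<mu> g v
      - \<beta> / Vol \<mu> * vint \<mu> v - ip \<mu> p v" for v
    unfolding R_def vint_cmult[symmetric] vint_add[symmetric] vint_diff[symmetric]
    by (intro arg_cong[of _ _ "vint \<mu>"] ext) (simp add: algebra_simps)
  have p_int: "vint \<mu> p = 0"
    unfolding p_def by (simp add: vint_sum vint_cmult U_mean)
  have R_perp: "R \<in> E_perp E w \<mu> lam k"
  proof (rule E_perpI_basis[OF basis])
    show "vint \<mu> R = 0"
      using R_ip[of "\<lambda>_. 1"] one Vol
      by (simp add: vint_laplacian[OF graph] u_perp(1) g_mass p_int)
    fix s i assume si: "s \<in> {1..k}" "i \<in> {1..n s}"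
    have "ip \<mu> p (U s i) = \<beta> * ip \<mu> g (U s i)"
      unfolding p_def by (rule ip_orthonormal_expansion[OF graph inj basis si])
    then show "ip \<mu> R (U s i) = 0"
      by (simp add: R_ip U_mean[OF si] u_perp(2)[OF si(1) U_eig[OF si]]
          ip_laplacian_eigenfunction[OF graph U_eig[OF si]])
  qed
  have p_orth: "ip \<mu> p R = 0"
  proof -
    have "ip \<mu> (U s i) R = 0" if "s \<in> {1..k}" "i \<in> {1..n s}" for s i
      using R_perp U_eig[OF that] that ip_commute[of \<mu> R] by (auto simp: E_perp_iff)
    then show ?thesis
      by (simp add: p_def sum_distrib_right vint_sum vint_cmult mult.assoc)
  qed
  have "dirichlet_form E w u R - \<alpha> * ip \<mu> u R =
      \<beta> * vint \<mu> (\<lambda>x. h x * R x * exp (u x)) / vint \<mu> (\<lambda>x. h x * exp (u x))"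
    by (intro first_variation[OF graph] h min E_perp_add E_perp_scaled u R_perp)
  then have "dirichlet_form E w u R - \<alpha> * ip \<mu> u R = \<beta> * ip \<mu> g R"
    by (simp add: g_int Z_def)
  moreover have "vint \<mu> R = 0"
    using R_perp by (simp add: E_perp_iff)
  ultimately have "ip \<mu> R R = 0"
    by (simp add: R_ip green_formula[OF graph] p_orth)
  then have "R x = 0"
    using ip_self_eq_0D pos by blast
  moreover have "p x = (\<Sum>s=1..k. \<Sum>i=1..n s.
      \<beta> * vint \<mu> (\<lambda>y. h y * U s i y * exp (u y)) / Z * U s i x)"
    by (simp add: p_def g_int)
  ultimately show ?thesis
    by (simp add: R_def g_def Z_def algebra_simps)
qed

theorem theorem2p5:
  fixes E :: "('v::finite \<times> 'v) set"
    and w :: "'v \<Rightarrow> 'v \<Rightarrow> real"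
    and \<mu> h :: "'v \<Rightarrow> real"
    and lam :: "nat \<Rightarrow> real"
    and n :: "nat \<Rightarrow> nat"
    and U :: "nat \<Rightarrow> nat \<Rightarrow> 'v \<Rightarrow> real"
    and m k :: nat
    and \<alpha> \<beta> :: real
  assumes graph: "weighted_graph E w \<mu>"
    and h_pos: "\<And>x. h x > 0"
    and lam_mono: "strict_mono_on {1..m - 1} lam"
    and lam_all: "lam ` {1..m - 1} = {l. l \<noteq> 0 \<and> eigenvalue E w \<mu> l}"
    and basis: "\<And>s. s \<in> {1..m - 1} \<Longrightarrow>
                  orthonormal_basis \<mu> (eigenspace E w \<mu> (lam s)) (n s) (U s)"
    and k: "k \<ge> 1" "k + 1 \<le> m - 1"
    and alpha: "\<alpha> < lam (k + 1)"
  shows "(bdd_below (J_functional E w \<mu> h \<alpha> \<beta> ` E_perp E w \<mu> lam k) \<and>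
          (\<exists>u \<in> E_perp E w \<mu> lam k.
             J_functional E w \<mu> h \<alpha> \<beta> u =
               (INF v \<in> E_perp E w \<mu> lam k. J_functional E w \<mu> h \<alpha> \<beta> v))) \<and>
         (\<exists>u \<in> E_perp E w \<mu> lam k. \<forall>x.
             laplacian E w \<mu> u x + \<alpha> * u x =
               - (\<beta> * h x * exp (u x)) / vint \<mu> (\<lambda>y. h y * exp (u y))
               + \<beta> / Vol \<mu>
               + (\<Sum>s=1..k. \<Sum>i=1..n s.
                    \<beta> * vint \<mu> (\<lambda>y. h y * U s i y * exp (u y))
                      / vint \<mu> (\<lambda>y. h y * exp (u y)) * U s i x))"
proof -
  let ?P = "E_perp E w \<mu> lam k" and ?J = "J_functional E w \<mu> h \<alpha> \<beta>"
  have sub: "{1..k} \<subseteq> {1..m - 1}" using k by auto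
  have inj: "inj_on lam {1..k}"
    using strict_mono_on_imp_inj_on[OF lam_mono] sub by (rule inj_on_subset)
  have nz: "0 \<notin> lam ` {1..k}"
    using image_mono[OF sub, of lam] lam_all by auto
  have next_eigenvalue: "lam (k + 1) \<le> l"
    if l: "l \<noteq> 0" "eigenvalue E w \<mu> l" "l \<notin> lam ` {1..k}" for l
  proof -
    from l lam_all obtain s where s: "s \<in> {1..m - 1}" "l = lam s" by blast
    with l(3) have "k + 1 \<le> s" by force
    with s k show ?thesis
      using strict_mono_on_leD[OF lam_mono, of "k + 1" s] by auto
  qed
  have gap: "lam (k + 1) * ip \<mu> v v \<le> dirichlet_form E w v v" if "v \<in> ?P" for v
    using graph next_eigenvalue that by (rule spectral_gap)
  obtain R where R: "\<And>u x. u \<in> ?P \<Longrightarrow> ?J u \<le> ?J (\<lambda>x. 0) \<Longrightarrow> \<bar>u x\<bar> \<le> R"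
    by (rule J_coercive[where S = ?P and \<beta> = \<beta> and M = "?J (\<lambda>x. 0)",
          OF graph h_pos alpha gap]) (assumption, rule that)
  have cont: "continuous_on ?P ?J"
    using graph h_pos by (rule continuous_on_J_functional)
  obtain u where u: "u \<in> ?P" and min: "\<And>v. v \<in> ?P \<Longrightarrow> ?J u \<le> ?J v"
    using continuous_attains_inf_bounded_sublevel[OF closed_E_perp E_perp_zero cont, of R] R
    by blast
  have "bdd_below (?J ` ?P)"
    using min by (intro bdd_belowI2[where m = "?J u"])
  moreover have "?J u = (INF v\<in>?P. ?J v)"
    using u min by (intro cInf_eq_minimum[symmetric]) auto
  moreover have "orthonormal_basis \<mu> (eigenspace E w \<mu> (lam s)) (n s) (U s)" if "s \<in> {1..k}" for s
    using basis[of s] sub that by blast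
  note critical_point_solves_kazdan_warner[where h = h, OF graph h_pos inj nz this u min]
  ultimately show ?thesis
    using u by (intro conjI bexI[of _ u] allI)
qed

end
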